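(* Let $T:\mathcal{B}\to\mathcal{B}$ be a nonzero bounded linear operator on the Bloch space $\mathcal{B}$. Then $T$ is almost multiplicative if and only if $T$ is a composition operator.
   Context: $\mathbb{D}$ is the open unit disc in $\mathbb{C}$. The Bloch space $\mathcal{B}$ is the Banach space of analytic functions $f$ on $\mathbb{D}$ with $\|f\|_{\mathcal{B}}=|f(0)|+\sup_{z\in\mathbb{D}}(1-|z|^2)|f'(z)|<\infty$. A bounded linear operator $T$ on a space $\mathcal{A}$ of analytic functions on $\mathbb{D}$ is almost multiplicative if $T(fg)=T(f)T(g)$ whenever $f,g,fg\in\mathcal{A}$ (pointwise product). $T$ is a composition operator on $\mathcal{A}$ if there is an analytic map $\varphi:\mathbb{D}\to\mathbb{D}$ such that $Tf=f\circ\varphi$ for all $f\in\mathcal{A}$. *)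

theory Defs
  imports "HOL-Complex_Analysis.Complex_Analysis"
begin

abbreviation unit_disc :: "complex set" where
  "unit_disc \<equiv> ball 0 1"

text \<open>A function on the disc is represented by its extension by zero to the whole plane.  Thus
  equality of functions on the disc is equality in HOL, and sums, scalar multiples and products
  are pointwise.\<close>

definition bloch_seminorm :: "(complex \<Rightarrow> complex) \<Rightarrow> real" where
  "bloch_seminorm f = (SUP z\<in>unit_disc. (1 - (norm z)\<^sup>2) * norm (deriv f z))"

definition bloch_norm :: "(complex \<Rightarrow> complex) \<Rightarrow> real" where
  "bloch_norm f = norm (f 0) + bloch_seminorm f"

text \<open>The supremum of an unbounded set of reals is unspecified, so finiteness of the norm is
  expressed by boundedness.\<close>

definition bloch :: "(complex \<Rightarrow> complex) set" where
  "bloch = {f. f analytic_on unit_disc \<and> (\<forall>z. z \<notin> unit_disc \<longrightarrow> f z = 0) \<and>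
     bdd_above ((\<lambda>z. (1 - (norm z)\<^sup>2) * norm (deriv f z)) ` unit_disc)}"

text \<open>In the following, \<open>A\<close> is a space of functions on the disc, with norm \<open>N\<close>; the values of
  \<open>T\<close> outside \<open>A\<close> are irrelevant.\<close>

definition bounded_operator_on ::
  "(complex \<Rightarrow> complex) set \<Rightarrow> ((complex \<Rightarrow> complex) \<Rightarrow> real) \<Rightarrow>
   ((complex \<Rightarrow> complex) \<Rightarrow> (complex \<Rightarrow> complex)) \<Rightarrow> bool" where
  "bounded_operator_on A N T \<longleftrightarrow>
     T \<in> A \<rightarrow> A \<and>
     (\<forall>f\<in>A. \<forall>g\<in>A. T (\<lambda>z. f z + g z) = (\<lambda>z. T f z + T g z)) \<and>
     (\<forall>c. \<forall>f\<in>A. T (\<lambda>z. c * f z) = (\<lambda>z. c * T f z)) \<and>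
     (\<exists>K. \<forall>f\<in>A. N (T f) \<le> K * N f)"

definition almost_multiplicative_on ::
  "(complex \<Rightarrow> complex) set \<Rightarrow> ((complex \<Rightarrow> complex) \<Rightarrow> (complex \<Rightarrow> complex)) \<Rightarrow> bool" where
  "almost_multiplicative_on A T \<longleftrightarrow>
     (\<forall>f\<in>A. \<forall>g\<in>A. (\<lambda>z. f z * g z) \<in> A \<longrightarrow> T (\<lambda>z. f z * g z) = (\<lambda>z. T f z * T g z))"

definition composition_operator_on ::
  "(complex \<Rightarrow> complex) set \<Rightarrow> ((complex \<Rightarrow> complex) \<Rightarrow> (complex \<Rightarrow> complex)) \<Rightarrow> bool" where
  "composition_operator_on A T \<longleftrightarrow>
     (\<exists>\<phi>. \<phi> analytic_on unit_disc \<and> \<phi> \<in> unit_disc \<rightarrow> unit_disc \<and>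
       (\<forall>f\<in>A. \<forall>z\<in>unit_disc. T f z = f (\<phi> z)))"

end

(* If f, g are Bloch functions with f - f(a) = (z - a) g on the disc, and phi = T z takes the value a
   at w, then multiplicativity and T 1 = 1 give (T f)(w) = f(a).  For |a| < 1 every Bloch function f
   admits such a g, because (1 - |z|^2) |f(z) - f(0)| is bounded; so only |phi| < 1 has to be shown.
   Values of modulus > 1 are impossible since z - a is then invertible in the Bloch space.  If
   |a| = 1, the functions - Log (1 - r cnj(a) z), 0 < r < 1, have Bloch norm at most 2, but the values
   - ln (1 - r) of their images under T at w are unbounded, contradicting boundedness of T. *)
theory Submission
  imports Defs
begin

section \<open>Zero extensions and membership in the Bloch space\<close>

definition on_disc :: "(complex \<Rightarrow> complex) \<Rightarrow> complex \<Rightarrow> complex" where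
  "on_disc f = (\<lambda>z. if z \<in> unit_disc then f z else 0)"

lemma on_disc_in [simp]: "norm z < 1 \<Longrightarrow> on_disc f z = f z"
  by (simp add: on_disc_def)

lemma deriv_on_disc: "norm z < 1 \<Longrightarrow> deriv (on_disc f) z = deriv f z"
proof -
  assume "norm z < 1"
  then have "\<forall>\<^sub>F x in nhds z. x \<in> unit_disc"
    by (intro eventually_nhds_in_open) auto
  then have "\<forall>\<^sub>F x in nhds z. on_disc f x = f x"
    by eventually_elim (simp add: on_disc_def)
  then show ?thesis by (rule deriv_cong_ev) simp
qed

lemma one_minus_norm_square:
  fixes z :: complex assumes "norm z < 1" shows "0 < 1 - (norm z)\<^sup>2" "1 - (norm z)\<^sup>2 \<le> 1"
  using assms by (auto simp: abs_square_less_1)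

lemma on_disc_in_bloch:
  assumes "f holomorphic_on unit_disc"
    and "\<And>z. norm z < 1 \<Longrightarrow> (1 - (norm z)\<^sup>2) * norm (deriv f z) \<le> C"
  shows "on_disc f \<in> bloch"
proof -
  have "on_disc f holomorphic_on unit_disc"
    using assms(1) by (rule holomorphic_transform) simp
  moreover have "bdd_above ((\<lambda>z. (1 - (norm z)\<^sup>2) * norm (deriv (on_disc f) z)) ` unit_disc)"
    using assms(2) by (intro bdd_aboveI[of _ C]) (auto simp: deriv_on_disc)
  ultimately show ?thesis
    by (auto simp: bloch_def analytic_on_open on_disc_def)
qed

lemma bloch_seminorm_on_disc_le:
  assumes "\<And>z. norm z < 1 \<Longrightarrow> (1 - (norm z)\<^sup>2) * norm (deriv f z) \<le> C"
  shows "bloch_seminorm (on_disc f) \<le> C"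
  unfolding bloch_seminorm_def
  by (rule cSUP_least) (use assms in \<open>auto simp: deriv_on_disc\<close>)

lemma bloch_holomorphic: "f \<in> bloch \<Longrightarrow> f holomorphic_on unit_disc"
  by (simp add: bloch_def analytic_on_open)

lemma bloch_deriv_bound:
  assumes "f \<in> bloch" "norm z < 1"
  shows "(1 - (norm z)\<^sup>2) * norm (deriv f z) \<le> bloch_seminorm f"
  unfolding bloch_seminorm_def
  by (rule cSUP_upper) (use assms in \<open>auto simp: bloch_def\<close>)

lemma bloch_seminorm_nonneg: "f \<in> bloch \<Longrightarrow> 0 \<le> bloch_seminorm f"
  using order_trans[OF norm_ge_zero[of "deriv f 0"], of "bloch_seminorm f"] bloch_deriv_bound[of f 0]
  by simp

text \<open>The derivative is bounded on the compact closed disc, and the weight is at most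
  1.\<close>

lemma holomorphic_nhd_in_bloch:
  assumes "f holomorphic_on S" "open S" "cball 0 1 \<subseteq> S"
  shows "on_disc f \<in> bloch"
proof -
  have "continuous_on (cball 0 1) (deriv f)"
    using assms by (meson holomorphic_deriv holomorphic_on_imp_continuous_on continuous_on_subset)
  then have "compact (deriv f ` cball 0 1)"
    by (rule compact_continuous_image) simp
  then obtain C where C: "\<And>z. norm z \<le> 1 \<Longrightarrow> norm (deriv f z) \<le> C"
    using compact_imp_bounded[THEN bounded_iff[THEN iffD1]] by fastforce
  show ?thesis
  proof (rule on_disc_in_bloch)
    show "f holomorphic_on unit_disc"
      using assms by (meson holomorphic_on_subset ball_subset_cball order_trans)
    show "(1 - (norm z)\<^sup>2) * norm (deriv f z) \<le> C" if "norm z < 1" for z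
    proof -
      have "(1 - (norm z)\<^sup>2) * norm (deriv f z) \<le> 1 * norm (deriv f z)"
        by (intro mult_right_mono) auto
      then show ?thesis using C[of z] that by linarith
    qed
  qed
qed

section \<open>Growth and division by z - a in the Bloch space\<close>

text \<open>On the segment from \<open>0\<close> to \<open>w\<close> the weight \<open>1 - \<bar>z\<bar>\<^sup>2\<close> is smallest at \<open>w\<close>.\<close>

lemma bloch_growth:
  assumes f: "f \<in> bloch" and w: "norm w < 1"
  shows "(1 - (norm w)\<^sup>2) * norm (f w - f 0) \<le> bloch_seminorm f"
proof -
  define M where "M = bloch_seminorm f / (1 - (norm w)\<^sup>2)"
  have pos: "0 < 1 - (norm w)\<^sup>2" using one_minus_norm_square[OF w] by simp
  have "norm (f w - f 0) \<le> M * norm (w - 0)"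
  proof (rule field_differentiable_bound[of "cball 0 (norm w)"])
    fix z :: complex assume "z \<in> cball 0 (norm w)"
    then have z: "norm z \<le> norm w" "norm z < 1" using w by auto
    show "(f has_field_derivative deriv f z) (at z within cball 0 (norm w))"
      using z(2)
      by (intro has_field_derivative_at_within[OF holomorphic_derivI[OF bloch_holomorphic[OF f]]]) auto
    have "(1 - (norm w)\<^sup>2) * norm (deriv f z) \<le> (1 - (norm z)\<^sup>2) * norm (deriv f z)"
      using z by (intro mult_right_mono) (auto intro!: power_mono)
    also have "\<dots> \<le> bloch_seminorm f" using bloch_deriv_bound f z by blast
    finally show "norm (deriv f z) \<le> M"
      using pos by (simp add: M_def field_simps)
  qed auto
  also have "\<dots> \<le> M * 1"
    using w pos bloch_seminorm_nonneg[OF f] by (intro mult_left_mono) (auto simp: M_def)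
  finally show ?thesis using pos by (simp add: M_def field_simps)
qed

text \<open>The singularity at \<open>a\<close> is removable. The formula for the quotient is total,
  so the identity holds at every \<open>z\<close>, also outside \<open>S\<close>.\<close>

lemma holomorphic_difference_quotient:
  assumes "f holomorphic_on S" "open S"
  obtains g where "g holomorphic_on S" "\<And>z. f z - f a = (z - a) * g z"
proof -
  have "(\<lambda>z. if z = a then deriv f a else (f z - f a) / (z - a)) holomorphic_on S"
    using assms by (rule pole_lemma_open)
  then show ?thesis by (rule that) auto
qed

text \<open>Near \<open>a\<close>, compactness bounds the derivative of the quotient. Away from
  \<open>a\<close>, the quotient rule leaves f' and f - f(a) over powers of z - a; the seminorm
  controls the weighted first numerator and \<open>bloch_growth\<close> the second.\<close>

lemma bloch_difference_quotient:
  assumes f: "f \<in> bloch" and a: "norm a < 1"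
  obtains g where "g \<in> bloch" "\<And>z. norm z < 1 \<Longrightarrow> f z - f a = (z - a) * g z"
proof -
  obtain h where h: "h holomorphic_on unit_disc" and fh: "\<And>z. f z - f a = (z - a) * h z"
    using holomorphic_difference_quotient[OF bloch_holomorphic[OF f], of a] by auto
  \<comment> \<open>A radius halfway between |a| and 1: the closed disc of radius \<open>R\<close>
    is compact in the unit disc, and points beyond it keep distance at least \<open>d\<close> from
    \<open>a\<close>.\<close>
  define R where "R = (1 + norm a) / 2"
  have R: "norm a < R" "R < 1" using a by (auto simp: R_def field_simps)
  define M where "M = bloch_seminorm f"
  have "continuous_on (cball 0 R) (deriv h)"
    using R by (intro holomorphic_on_imp_continuous_on holomorphic_on_subset[OF holomorphic_deriv[OF h]]) auto
  then have "compact (deriv h ` cball 0 R)"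
    by (rule compact_continuous_image) simp
  then obtain C where C: "\<And>z. norm z \<le> R \<Longrightarrow> norm (deriv h z) \<le> C"
    using compact_imp_bounded[THEN bounded_iff[THEN iffD1]] by fastforce
  define d where "d = R - norm a"
  have d: "0 < d" using R by (simp add: d_def)
  define L where "L = M / d + (M + norm (f 0 - f a)) / d\<^sup>2"
  have M: "0 \<le> M" unfolding M_def using bloch_seminorm_nonneg f by blast
  have "(1 - (norm z)\<^sup>2) * norm (deriv h z) \<le> max C L" if z: "norm z < 1" for z
  proof (cases "norm z \<le> R")
    case True
    have "(1 - (norm z)\<^sup>2) * norm (deriv h z) \<le> 1 * norm (deriv h z)"
      by (intro mult_right_mono) auto
    with C[OF True] show ?thesis by linarith
  next
    case False
    define s where "s = 1 - (norm z)\<^sup>2"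
    have s: "0 < s" "s \<le> 1" using one_minus_norm_square[OF z] by (auto simp: s_def)
    have dz: "d \<le> norm (z - a)" using False norm_triangle_ineq2[of z a] by (simp add: d_def)
    have za: "z \<noteq> a" using False R by auto
    have "((\<lambda>z. f z - f a) has_field_derivative deriv f z) (at z)"
      using holomorphic_derivI[OF bloch_holomorphic[OF f], of z] z
      by (auto intro!: derivative_eq_intros)
    moreover have "((\<lambda>z. (z - a) * h z) has_field_derivative h z + (z - a) * deriv h z) (at z)"
      using holomorphic_derivI[OF h, of z] z
      by (auto intro!: derivative_eq_intros)
    \<comment> \<open>By \<open>fh\<close> both derivatives belong to the same function.\<close>
    ultimately have "deriv f z = h z + (z - a) * deriv h z"
      using fh DERIV_unique by auto
    then have dh: "deriv h z = deriv f z / (z - a) - (f z - f a) / (z - a)\<^sup>2"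
      using za by (simp add: fh divide_simps power2_eq_square)
    have 1: "s * norm (deriv f z) \<le> M"
      unfolding s_def M_def using bloch_deriv_bound f z by blast
    have "s * norm (f z - f a) \<le> s * (norm (f z - f 0) + norm (f 0 - f a))"
      using s norm_triangle_ineq[of "f z - f 0" "f 0 - f a"] by (intro mult_left_mono) auto
    also have "\<dots> \<le> M + 1 * norm (f 0 - f a)"
      unfolding distrib_left
      using bloch_growth[OF f z] s by (intro add_mono mult_right_mono) (auto simp: s_def M_def)
    finally have 2: "s * norm (f z - f a) \<le> M + norm (f 0 - f a)" by simp
    have "s * norm (deriv h z) \<le> s * (norm (deriv f z / (z - a)) + norm ((f z - f a) / (z - a)\<^sup>2))"
      unfolding dh using s norm_triangle_ineq4 by (intro mult_left_mono) auto
    also have "\<dots> = s * norm (deriv f z) / norm (z - a) + s * norm (f z - f a) / (norm (z - a))\<^sup>2"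
      by (simp add: norm_divide norm_power distrib_left)
    also have "\<dots> \<le> L"
      unfolding L_def using 1 2 dz d M s
      by (intro add_mono frac_le power_mono) auto
    finally show ?thesis by (simp add: s_def)
  qed
  then have "on_disc h \<in> bloch" by (intro on_disc_in_bloch[OF h])
  then show ?thesis by (rule that) (simp add: fh)
qed

section \<open>Logarithmic test functions\<close>

definition log_kernel :: "complex \<Rightarrow> complex \<Rightarrow> complex" where
  "log_kernel c z = - Ln (1 - c * z)"

lemma Re_one_minus_pos:
  assumes "norm (z::complex) < 1" shows "0 < Re (1 - z)"
  using assms complex_Re_le_cmod[of z] by simp

lemma log_kernel_derivative:
  assumes "norm (c * z) < 1"
  shows "(log_kernel c has_field_derivative c / (1 - c * z)) (at z)"
  unfolding log_kernel_def using Re_one_minus_pos[OF assms]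
  by (auto intro!: derivative_eq_intros simp: complex_nonpos_Reals_iff divide_inverse)

text \<open>The weight factors as (1 - |z|)(1 + |z|), and |1 - cz| >= 1 - |z| cancels the first
  factor. The bound is uniform in \<open>c\<close>, although the kernels become large near the
  boundary as |c| tends to 1.\<close>

lemma log_kernel_deriv_bound:
  assumes c: "norm c \<le> 1" and z: "norm z < 1"
  shows "(1 - (norm z)\<^sup>2) * norm (deriv (log_kernel c) z) \<le> 2"
proof -
  have cz: "norm (c * z) \<le> norm z"
    using mult_right_mono[OF c norm_ge_zero[of z]] by (simp add: norm_mult)
  have low: "1 - norm z \<le> norm (1 - c * z)"
    using norm_triangle_ineq2[of 1 "c * z"] cz by simp
  have "deriv (log_kernel c) z = c / (1 - c * z)"
    using cz z by (intro DERIV_imp_deriv log_kernel_derivative) auto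
  then have "norm (deriv (log_kernel c) z) \<le> 1 / (1 - norm z)"
    using low c z by (auto simp: norm_divide intro!: frac_le)
  then have "(1 - (norm z)\<^sup>2) * norm (deriv (log_kernel c) z) \<le> (1 - (norm z)\<^sup>2) * (1 / (1 - norm z))"
    using one_minus_norm_square[OF z] by (intro mult_left_mono) auto
  also have "\<dots> = 1 + norm z" using z by (simp add: field_simps power2_eq_square)
  finally show ?thesis using z by linarith
qed

text \<open>For |c| < 1 this allows a radius above 1, so that the kernel can be evaluated at points
  of the unit circle.\<close>

lemma log_kernel_holomorphic:
  assumes "norm c * r \<le> 1"
  shows "log_kernel c holomorphic_on ball 0 r"
proof -
  have "norm (c * z) < 1" if z: "norm z < r" for z
  proof (cases "c = 0")
    case False
    then have "norm (c * z) < norm c * r" using z by (simp add: norm_mult)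
    then show ?thesis using assms by simp
  qed simp
  then show ?thesis
    using log_kernel_derivative by (force simp: holomorphic_on_open)
qed

section \<open>From almost multiplicative operators to composition operators\<close>

locale multiplicative_bloch_operator =
  fixes T :: "(complex \<Rightarrow> complex) \<Rightarrow> (complex \<Rightarrow> complex)"
  assumes bounded: "bounded_operator_on bloch bloch_norm T"
    and nonzero: "\<exists>f\<in>bloch. T f \<noteq> (\<lambda>z. 0)"
    and multiplicative: "almost_multiplicative_on bloch T"
begin

lemma T_bloch: "f \<in> bloch \<Longrightarrow> T f \<in> bloch"
  and T_add: "f \<in> bloch \<Longrightarrow> g \<in> bloch \<Longrightarrow> T (\<lambda>z. f z + g z) = (\<lambda>z. T f z + T g z)"
  and T_scale: "f \<in> bloch \<Longrightarrow> T (\<lambda>z. c * f z) = (\<lambda>z. c * T f z)"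
  using bounded by (auto simp: bounded_operator_on_def)

lemma T_mult:
  "f \<in> bloch \<Longrightarrow> g \<in> bloch \<Longrightarrow> (\<lambda>z. f z * g z) \<in> bloch \<Longrightarrow> T (\<lambda>z. f z * g z) = (\<lambda>z. T f z * T g z)"
  using multiplicative by (auto simp: almost_multiplicative_on_def)

abbreviation one :: "complex \<Rightarrow> complex" where "one \<equiv> on_disc (\<lambda>z. 1)"

lemma one_bloch: "one \<in> bloch"
  by (rule holomorphic_nhd_in_bloch[of _ UNIV]) auto

lemma one_mult: "f \<in> bloch \<Longrightarrow> (\<lambda>z. one z * f z) = f"
  by (auto simp: bloch_def on_disc_def fun_eq_iff)

text \<open>T 1 is idempotent, so its values are 0 or 1, and it is constant on the connected disc.
  The constant 0 would make T f = T 1 * T f vanish for every f.\<close>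

lemma T_one:
  assumes w: "norm w < 1"
  shows "T one w = 1"
proof -
  have T1: "T f z = T one z * T f z" if "f \<in> bloch" for f z
    using T_mult[OF one_bloch that] that one_mult[OF that] by (simp add: fun_eq_iff)
  have idem: "T one z = 0 \<or> T one z = 1" for z
    using T1[OF one_bloch, of z] by auto
  have "continuous_on unit_disc (T one)"
    by (intro holomorphic_on_imp_continuous_on bloch_holomorphic T_bloch one_bloch)
  moreover have "finite (T one ` unit_disc)"
    by (rule finite_subset[of _ "{0, 1}"]) (use idem in auto)
  ultimately have "T one constant_on unit_disc"
    by (intro continuous_finite_range_constant) auto
  then obtain c where c: "\<And>z. z \<in> unit_disc \<Longrightarrow> T one z = c"
    by (auto simp: constant_on_def)
  show ?thesis
  proof (rule ccontr)
    assume "T one w \<noteq> 1"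
    then have "c = 0" using idem[of w] c[of w] w by auto
    have "T f z = 0" if "f \<in> bloch" for f z
    proof (cases "z \<in> unit_disc")
      case True then show ?thesis using T1[OF that, of z] c \<open>c = 0\<close> by simp
    next
      case False then show ?thesis using T_bloch[OF that] by (simp add: bloch_def)
    qed
    then show False using nonzero by (auto simp: fun_eq_iff)
  qed
qed

text \<open>If T is composition with some map, applying T to the identity recovers that map, so this
  is the only candidate.\<close>

definition symbol :: "complex \<Rightarrow> complex" where
  "symbol = T (on_disc (\<lambda>z. z))"

lemma id_bloch: "on_disc (\<lambda>z. z) \<in> bloch"
  by (rule holomorphic_nhd_in_bloch[of _ UNIV]) auto

lemma symbol_analytic: "symbol analytic_on unit_disc"
  using T_bloch[OF id_bloch] by (simp add: symbol_def bloch_def)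

lemma linear_bloch: "on_disc (\<lambda>z. z - a) \<in> bloch"
  by (rule holomorphic_nhd_in_bloch[of _ UNIV]) (auto intro!: holomorphic_intros)

lemma scale_one_bloch: "(\<lambda>z. c * one z) \<in> bloch"
proof -
  have "on_disc (\<lambda>z. c) \<in> bloch" by (rule holomorphic_nhd_in_bloch[of _ UNIV]) auto
  also have "on_disc (\<lambda>z. c) = (\<lambda>z. c * one z)" by (auto simp: on_disc_def)
  finally show ?thesis .
qed

lemma T_linear:
  assumes "norm w < 1"
  shows "T (on_disc (\<lambda>z. z - a)) w = symbol w - a"
proof -
  have "on_disc (\<lambda>z. z - a) = (\<lambda>z. on_disc (\<lambda>z. z) z + (- a) * one z)"
    by (auto simp: on_disc_def)
  then have "T (on_disc (\<lambda>z. z - a)) w = symbol w + (- a) * T one w"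
    using T_add[OF id_bloch scale_one_bloch, of "- a"] T_scale[OF one_bloch, of "- a"]
    by (simp add: symbol_def)
  then show ?thesis using T_one[OF assms] by simp
qed

text \<open>Apply T to f = b + (z - \<open>symbol w\<close>) g: the image of the linear factor
  vanishes at \<open>w\<close>. The value is a free \<open>b\<close> because \<open>symbol w\<close>
  is not yet known to lie in the disc, outside which \<open>f\<close> is 0 by convention.\<close>

lemma T_eval:
  assumes f: "f \<in> bloch" and g: "g \<in> bloch" and w: "norm w < 1"
    and fg: "\<And>z. norm z < 1 \<Longrightarrow> f z = b + (z - symbol w) * g z"
  shows "T f w = b"
proof -
  define l where "l = on_disc (\<lambda>z. z - symbol w)"
  have l: "l \<in> bloch" unfolding l_def by (rule linear_bloch)
  have f0: "f z = 0" if "\<not> norm z < 1" for z using f that by (auto simp: bloch_def)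
  have fe: "f = (\<lambda>z. l z * g z + b * one z)"
    using fg f0 by (auto simp: l_def on_disc_def fun_eq_iff)
  \<comment> \<open>Multiplicativity needs the product in the Bloch space, which is not closed under
    products; here the product is f - b on the disc.\<close>
  have lg: "(\<lambda>z. l z * g z) \<in> bloch"
  proof -
    have hol: "(\<lambda>z. f z - b) holomorphic_on unit_disc"
      by (intro holomorphic_intros bloch_holomorphic f)
    have "deriv (\<lambda>z. f z - b) z = deriv f z" if "norm z < 1" for z
      using holomorphic_derivI[OF bloch_holomorphic[OF f], of z] that
      by (intro DERIV_imp_deriv) (auto intro!: derivative_eq_intros)
    then have "on_disc (\<lambda>z. f z - b) \<in> bloch"
      by (intro on_disc_in_bloch[OF hol, where C = "bloch_seminorm f"]) (simp add: bloch_deriv_bound f)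
    also have "on_disc (\<lambda>z. f z - b) = (\<lambda>z. l z * g z)"
      using fg by (auto simp: l_def on_disc_def fun_eq_iff)
    finally show ?thesis .
  qed
  have "T f w = T (\<lambda>z. l z * g z) w + b * T one w"
    by (subst fe) (simp add: T_add[OF lg scale_one_bloch] T_scale[OF one_bloch])
  also have "T (\<lambda>z. l z * g z) w = 0"
    using T_mult[OF l g lg] T_linear[OF w, of "symbol w"] by (simp add: l_def)
  finally show ?thesis using T_one[OF w] by simp
qed

lemma T_eval_holomorphic_nhd:
  assumes f: "f holomorphic_on S" "open S" "cball 0 1 \<subseteq> S" and w: "norm w < 1" "symbol w \<in> S"
  shows "T (on_disc f) w = f (symbol w)"
proof -
  obtain g where g: "g holomorphic_on S" "\<And>z. f z - f (symbol w) = (z - symbol w) * g z"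
    using holomorphic_difference_quotient[OF f(1,2)] by blast
  show ?thesis
    using holomorphic_nhd_in_bloch[OF f] holomorphic_nhd_in_bloch[OF g(1) f(2,3)] w(1)
    by (rule T_eval) (simp flip: g(2))
qed

lemma symbol_le_1:
  assumes w: "norm w < 1"
  shows "norm (symbol w) \<le> 1"
proof (rule ccontr)
  define a where "a = symbol w"
  assume "\<not> norm (symbol w) \<le> 1"
  then have a: "1 < norm a" by (simp add: a_def)
  have g: "on_disc (\<lambda>z. - 1 / (z - a)) \<in> bloch"
  proof (rule holomorphic_nhd_in_bloch[of _ "- {a}"])
    show "(\<lambda>z. - 1 / (z - a)) holomorphic_on - {a}"
      by (intro holomorphic_intros) auto
  qed (use a in auto)
  \<comment> \<open>The zero function is 1 + (z - a) g, so evaluation would give T 0 the value 1 at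
    \<open>w\<close>.\<close>
  have "T (\<lambda>z. 0 * one z) w = 1"
  proof (rule T_eval[OF scale_one_bloch g w])
    fix z :: complex assume "norm z < 1"
    with a show "0 * one z = 1 + (z - symbol w) * on_disc (\<lambda>z. - 1 / (z - a)) z"
      by (auto simp: a_def)
  qed
  then show False using T_scale[OF one_bloch, of 0] by simp
qed

lemma symbol_neq_1:
  assumes w: "norm w < 1"
  shows "norm (symbol w) \<noteq> 1"
proof
  define a where "a = symbol w"
  assume "norm (symbol w) = 1"
  then have a: "norm a = 1" by (simp add: a_def)
  obtain K where K: "\<And>f. f \<in> bloch \<Longrightarrow> bloch_norm (T f) \<le> K * bloch_norm f"
    using bounded unfolding bounded_operator_on_def by blast
  define s where "s = 1 - (norm w)\<^sup>2"
  have s: "0 < s" "s \<le> 1" using one_minus_norm_square[OF w] by (auto simp: s_def)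
  \<comment> \<open>Chosen so that s * B = 2|K| + s exceeds 2|K|, the bound that the operator norm
    imposes.\<close>
  define B where "B = 2 * \<bar>K\<bar> / s + 1"
  have B: "B > 0" using s by (auto simp: B_def intro!: add_nonneg_pos)
  \<comment> \<open>Solves - ln (1 - r) = B; positivity of \<open>B\<close> puts \<open>r\<close>
    strictly between 0 and 1.\<close>
  define r where "r = 1 - exp (- B)"
  have r: "0 < r" "r < 1" using B by (auto simp: r_def)
  \<comment> \<open>The conjugate makes c * a = r, since |a| = 1.\<close>
  define c where "c = of_real r * cnj a"
  have c: "norm c = r" using r a by (simp add: c_def norm_mult)
  define f where "f = on_disc (log_kernel c)"
  have hol: "log_kernel c holomorphic_on ball 0 (1 / r)"
    using c r by (intro log_kernel_holomorphic) simp
  have sub: "cball (0::complex) 1 \<subseteq> ball 0 (1 / r)"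
    using r by (simp add: cball_subset_ball_iff)
  have f: "f \<in> bloch"
    unfolding f_def by (rule holomorphic_nhd_in_bloch[OF hol _ sub]) simp
  have "c * a = of_real r"
    using a by (simp add: c_def complex_norm_square[symmetric] mult.assoc mult.commute[of "cnj a"])
  then have "log_kernel c a = - Ln (of_real (exp (- B)))"
    by (simp add: log_kernel_def r_def)
  also have "\<dots> = of_real B"
    by (subst Ln_of_real) auto
  finally have val: "T f w = of_real B"
    unfolding f_def using T_eval_holomorphic_nhd[OF hol _ sub w] a r by (simp add: a_def)
  have "bloch_seminorm f \<le> 2"
    unfolding f_def using c r by (intro bloch_seminorm_on_disc_le log_kernel_deriv_bound) auto
  \<comment> \<open>The kernel vanishes at 0, so only the seminorm contributes. Nonnegativity allows
    replacing \<open>K\<close>, which may be negative, by its absolute value.\<close>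
  then have nf: "bloch_norm f \<le> 2" "0 \<le> bloch_norm f"
    using bloch_seminorm_nonneg[OF f] by (auto simp: bloch_norm_def f_def log_kernel_def)
  \<comment> \<open>The growth estimate for T f turns its large value at \<open>w\<close> into a
    lower bound for its norm.\<close>
  have "s * B = s * norm (T f w)" using val B by simp
  also have "\<dots> \<le> s * (norm (T f w - T f 0) + norm (T f 0))"
    using s norm_triangle_ineq[of "T f w - T f 0" "T f 0"] by (intro mult_left_mono) auto
  also have "\<dots> \<le> bloch_seminorm (T f) + 1 * norm (T f 0)"
    unfolding distrib_left using bloch_growth[OF T_bloch[OF f] w] s
    by (intro add_mono mult_right_mono) (auto simp: s_def)
  also have "\<dots> = bloch_norm (T f)" by (simp add: bloch_norm_def)
  also have "\<dots> \<le> K * bloch_norm f" by (rule K[OF f])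
  also have "\<dots> \<le> \<bar>K\<bar> * 2" using nf by (intro mult_mono) auto
  finally have "s * B \<le> 2 * \<bar>K\<bar>" by simp
  moreover have "s * B = 2 * \<bar>K\<bar> + s" using s by (simp add: B_def field_simps)
  ultimately show False using s by simp
qed

lemma symbol_less_1: "norm w < 1 \<Longrightarrow> norm (symbol w) < 1"
  using symbol_le_1[of w] symbol_neq_1[of w] by simp

lemma T_eq_comp_symbol:
  assumes f: "f \<in> bloch" and w: "norm w < 1"
  shows "T f w = f (symbol w)"
proof -
  obtain g where g: "g \<in> bloch"
    "\<And>z. norm z < 1 \<Longrightarrow> f z - f (symbol w) = (z - symbol w) * g z"
    using bloch_difference_quotient[OF f symbol_less_1[OF w]] by blast
  show ?thesis
    by (rule T_eval[OF f g(1) w]) (simp flip: g(2))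
qed

lemma composition_operator: "composition_operator_on bloch T"
  unfolding composition_operator_on_def
  using symbol_analytic symbol_less_1 T_eq_comp_symbol by (intro exI[of _ symbol]) auto

end

section \<open>Composition operators are almost multiplicative\<close>

lemma composition_operator_multiplicative:
  assumes T: "T \<in> bloch \<rightarrow> bloch" and "composition_operator_on bloch T"
  shows "almost_multiplicative_on bloch T"
proof -
  obtain \<phi> where \<phi>: "\<And>f z. f \<in> bloch \<Longrightarrow> z \<in> unit_disc \<Longrightarrow> T f z = f (\<phi> z)"
    using assms(2) by (auto simp: composition_operator_on_def)
  \<comment> \<open>The composition formula speaks only of the disc; elsewhere both sides are 0
    because T maps into \<open>bloch\<close>.\<close>
  have outside: "T f z = 0" if "f \<in> bloch" "z \<notin> unit_disc" for f z
    using T that by (auto simp: bloch_def Pi_iff)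
  show ?thesis
    unfolding almost_multiplicative_on_def
  proof (intro ballI impI ext)
    fix f g z assume fg: "f \<in> bloch" "g \<in> bloch" "(\<lambda>z. f z * g z) \<in> bloch"
    show "T (\<lambda>z. f z * g z) z = T f z * T g z"
      by (cases "z \<in> unit_disc") (simp_all add: \<phi> outside fg del: mem_ball)
  qed
qed

theorem theorem4p4:
  fixes T :: "(complex \<Rightarrow> complex) \<Rightarrow> (complex \<Rightarrow> complex)"
  assumes "bounded_operator_on bloch bloch_norm T"
    and "\<exists>f\<in>bloch. T f \<noteq> (\<lambda>z. 0)"
  shows "almost_multiplicative_on bloch T \<longleftrightarrow> composition_operator_on bloch T"
proof
  assume "almost_multiplicative_on bloch T"
  then interpret multiplicative_bloch_operator T
    using assms by unfold_locales
  show "composition_operator_on bloch T" by (rule composition_operator)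
next
  assume "composition_operator_on bloch T"
  then show "almost_multiplicative_on bloch T"
    using assms(1) by (intro composition_operator_multiplicative) (auto simp: bounded_operator_on_def)
qed

end
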